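(* Let $t\ge 2$ and $n,r\ge 1$ be integers. Let $X_1,\dots,X_n,Y$ and $E_1,\dots,E_r$ be non-empty sets, $\mathcal{H}$ a family of mappings from $X_1\times\cdots\times X_n$ to $Y$, $K_1,\dots,K_t$ (non-empty) compact Hausdorff spaces, $G_1,\dots,G_t$ Banach spaces, and let $$R_j:K_j\times E_1\times\cdots\times E_r\times G_j\to[0,\infty)\ (j=1,\dots,t),\qquad S:\mathcal{H}\times E_1\times\cdots\times E_r\times G_1\times\cdots\times G_t\to[0,\infty)$$ be mappings satisfying: (1) for each $j\in\{1,\dots,t\}$, all $x^{(l)}\in E_l$ ($l=1,\dots,r$) and all $b\in G_j$, the map $K_j\to[0,\infty)$, $\varphi\mapsto R_j(\varphi,x^{(1)},\dots,x^{(r)},b)$ is continuous; (2) $R_j(\varphi,x^{(1)},\dots,x^{(r)},\eta_j b^{(j)})\le \eta_j R_j(\varphi,x^{(1)},\dots,x^{(r)},b^{(j)})$ and $S(f,x^{(1)},\dots,x^{(r)},\alpha_1b^{(1)},\dots,\alpha_tb^{(t)})\ge\alpha_1\cdots\alpha_t\,S(f,x^{(1)},\dots,x^{(r)},b^{(1)},\dots,b^{(t)})$ for all $j=1,\dots,t$, $\varphi\in K_j$, $x^{(l)}\in E_l$, $0\le\eta_j,\alpha_j\le 1$, $b^{(j)}\in G_j$ and $f\in\mathcal{H}$. Let $f\in\mathcal{H}$ and let $0<p^{*},u,s,p_1,\dots,p_{t-1},q_1,\dots,q_{t-1}<\infty$ be such that $$\frac1u=\frac1{p_1}+\cdots+\frac1{p_{t-1}}+\frac1{p^{*}}\quad\text{and}\quad\frac1s=\frac1{q_1}+\cdots+\frac1{q_{t-1}}+\frac1{p^{*}}.$$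 Suppose that for every $k=1,\dots,t-1$ and all $x_1\in E_1,\dots,x_r\in E_r$, $b\in G_k$, the map $\varphi\in K_k\mapsto R_k(\varphi,x_1,\dots,x_r,b)$ is constant. Then the following are equivalent: (i) $f$ is $R_1,\dots,R_t$-$S$-abstract $(p_1,\dots,p_{t-1},p^{*})$-summing; (ii) $f$ is $R_1,\dots,R_t$-$S$-abstract $(q_1,\dots,q_{t-1},p^{*})$-summing.
   Context: Definition. Let $0<p_1,\dots,p_t,p_0<\infty$ with $\frac1{p_0}=\frac1{p_1}+\cdots+\frac1{p_t}$. A mapping $f\in\mathcal{H}$ is $R_1,\dots,R_t$-$S$-abstract $(p_1,\dots,p_t)$-summing if there is a $C>0$ such that $$\Big(\sum_{i=1}^m S(f,x_i^{(1)},\dots,x_i^{(r)},b_i^{(1)},\dots,b_i^{(t)})^{p_0}\Big)^{1/p_0}\le C\prod_{k=1}^t\sup_{\varphi\in K_k}\Big(\sum_{i=1}^m R_k(\varphi,x_i^{(1)},\dots,x_i^{(r)},b_i^{(k)})^{p_k}\Big)^{1/p_k}$$ for all $m\in\mathbb{N}$, $x_1^{(s)},\dots,x_m^{(s)}\in E_s$ ($s=1,\dots,r$) and $b_1^{(l)},\dots,b_m^{(l)}\in G_l$ ($l=1,\dots,t$). *)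

theory Defs
  imports "HOL-Analysis.Analysis" "HOL-Algebra.Algebraic_Closure_Type"
begin

text \<open>
  Finitely many Banach spaces that need not be related to each other cannot be indexed by a
  number if each of them is a type, so a Banach space is a carrier with operations here.
  Up to isomorphism, the instances of class \<^class>\<open>real_normed_field\<close> are exactly the real
  and the complex numbers with their usual norms (Gelfand-Mazur), so the type of scalars
  \<open>'a\<close> below stands for the scalar field.
  The fields \<open>mult\<close> and \<open>one\<close> that the record inherits play no role.
\<close>

record ('a, 'b) normed_module = "('a, 'b) Module.module" +
  vnorm :: "'b \<Rightarrow> real"

definition vdist :: "('a, 'b, 'm) normed_module_scheme \<Rightarrow> 'b \<Rightarrow> 'b \<Rightarrow> real" where
  "vdist G x y = (if x \<in> carrier G \<and> y \<in> carrier G then vnorm G (x \<ominus>\<^bsub>G\<^esub> y) else 0)"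
  \<comment> \<open>The locale \<^locale>\<open>Metric_space\<close> asks for symmetry and non-negativity also off the carrier.\<close>

locale banach_module =
  Module.module "ring_of_type_algebra :: 'a::real_normed_field ring" G
  for G :: "('a::real_normed_field, 'b, 'm) normed_module_scheme" (structure) +
  assumes vnorm_nonneg: "x \<in> carrier G \<Longrightarrow> 0 \<le> vnorm G x"
    and vnorm_eq_zero_iff: "x \<in> carrier G \<Longrightarrow> vnorm G x = 0 \<longleftrightarrow> x = \<zero>"
    and vnorm_smult: "x \<in> carrier G \<Longrightarrow> vnorm G (c \<odot>\<^bsub>G\<^esub> x) = norm c * vnorm G x"
    and vnorm_triangle:
      "\<lbrakk>x \<in> carrier G; y \<in> carrier G\<rbrakk> \<Longrightarrow> vnorm G (x \<oplus>\<^bsub>G\<^esub> y) \<le> vnorm G x + vnorm G y"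
    and complete: "Metric_space.mcomplete (carrier G) (vdist G)"
begin

lemma vnorm_minus:
  assumes "x \<in> carrier G"
  shows "vnorm G (\<ominus> x) = vnorm G x"
proof -
  let ?R = "ring_of_type_algebra :: 'a ring"
  have "\<ominus>\<^bsub>?R\<^esub> 1 = (- 1 :: 'a)"
    by (rule R.minus_equality) (auto simp: ring_of_type_algebra_def)
  then have "\<ominus> x = (- 1) \<odot>\<^bsub>G\<^esub> x"
    using smult_l_minus[of 1 x] smult_one[of x] assms by (simp add: ring_of_type_algebra_def)
  then show ?thesis
    using vnorm_smult[OF assms, of "- 1"] by simp
qed

lemma Metric_space_vdist: "Metric_space (carrier G) (vdist G)"
proof
  show "0 \<le> vdist G x y" for x y
    by (simp add: vdist_def vnorm_nonneg)
  show "vdist G x y = vdist G y x" for x y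
  proof -
    have "y \<ominus> x = \<ominus> (x \<ominus> y)" if "x \<in> carrier G" "y \<in> carrier G"
      using that by (simp add: a_minus_def M.minus_add M.a_comm)
    then show ?thesis
      by (simp add: vdist_def vnorm_minus)
  qed
  show "vdist G x y = 0 \<longleftrightarrow> x = y" if "x \<in> carrier G" "y \<in> carrier G" for x y
  proof -
    have "x \<ominus> y = \<zero> \<longleftrightarrow> x = y"
      using that by (metis M.a_inv_closed M.minus_equality M.minus_minus M.r_neg a_minus_def)
    then show ?thesis
      using that by (simp add: vdist_def vnorm_eq_zero_iff)
  qed
  show "vdist G x z \<le> vdist G x y + vdist G y z"
    if "x \<in> carrier G" "y \<in> carrier G" "z \<in> carrier G" for x y z
  proof -
    have "x \<ominus> z = (x \<ominus> y) \<oplus> (y \<ominus> z)"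
      using that by (simp add: a_minus_def M.a_assoc M.r_neg2 M.r_neg1)
    then show ?thesis
      using that vnorm_triangle[of "x \<ominus> y" "y \<ominus> z"] by (simp add: vdist_def)
  qed
qed

end

text \<open>
  A point of \<open>E\<^sub>1 \<times> \<dots> \<times> E\<^sub>r\<close> is a function in \<open>\<Pi>\<^sub>E l\<in>{1..r}. E l\<close>, and similarly for the other
  finite products. The supremum is a supremum of reals; it is meaningful if every \<open>K k\<close> is
  compact and non-empty and \<open>R k\<close> is continuous in its first argument, since the set is then
  bounded.
\<close>

definition abstract_summing ::
  "nat \<Rightarrow> nat \<Rightarrow> (nat \<Rightarrow> 'e set) \<Rightarrow> (nat \<Rightarrow> 'k topology)
   \<Rightarrow> (nat \<Rightarrow> ('a, 'g, 'm) normed_module_scheme)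
   \<Rightarrow> (nat \<Rightarrow> 'k \<Rightarrow> (nat \<Rightarrow> 'e) \<Rightarrow> 'g \<Rightarrow> real)
   \<Rightarrow> ('f \<Rightarrow> (nat \<Rightarrow> 'e) \<Rightarrow> (nat \<Rightarrow> 'g) \<Rightarrow> real)
   \<Rightarrow> (nat \<Rightarrow> real) \<Rightarrow> 'f \<Rightarrow> bool" where
  "abstract_summing r t E K G R S p f \<longleftrightarrow>
     (\<forall>k\<in>{1..t}. 0 < p k) \<and>
     (\<exists>p0>0. 1 / p0 = (\<Sum>k=1..t. 1 / p k) \<and>
       (\<exists>C>0. \<forall>(m::nat) x b.
          (\<forall>i\<in>{1..m}. x i \<in> (\<Pi>\<^sub>E l\<in>{1..r}. E l)) \<longrightarrow>
          (\<forall>i\<in>{1..m}. b i \<in> (\<Pi>\<^sub>E k\<in>{1..t}. carrier (G k))) \<longrightarrow>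
          (\<Sum>i=1..m. S f (x i) (b i) powr p0) powr (1 / p0)
          \<le> C * (\<Prod>k=1..t. SUP \<phi>\<in>topspace (K k).
                    (\<Sum>i=1..m. R k \<phi> (x i) (b i k) powr p k) powr (1 / p k))))"

end

theory Submission
  imports Defs
begin

text \<open>
  For \<open>k < t\<close> write \<open>\<rho> k x b\<close> for the constant value of \<open>R k \<phi> x b\<close>. Both summability
  properties are equivalent to one and the same condition, in which the exponents \<open>p k\<close> and
  \<open>q k\<close> with \<open>k < t\<close> do not occur: \<open>S\<close> vanishes wherever \<open>\<Prod>k<t. \<rho> k\<close> does, and the
  quotients \<open>T i = S f (x i) (b i) / (\<Prod>k<t. \<rho> k (x i) (b i k))\<close> satisfy
  \<open>(\<Sum>i. T i powr pstar) powr (1 / pstar) \<le> C * W\<close>, where \<open>W\<close> is the supremum factor of \<open>R t\<close>.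
  This is \<open>abstract_summing_iff_normalized_summing\<close>.

  Given the condition, \<open>S f (x i) (b i) = T i * (\<Prod>k<t. \<rho> k (x i) (b i k))\<close>, and Hoelder's
  inequality with \<open>t\<close> factors (\<open>Hoelder_sum_prod\<close>) gives summability with any exponents
  \<open>p k\<close> for \<open>k < t\<close>.

  For the converse, the vectors \<open>b i k\<close> with \<open>k < t\<close> are rescaled so that Hoelder's inequality
  becomes an equality: the scaling hypotheses allow one to turn \<open>\<rho> k\<close> into a quantity at most
  \<open>c * T i powr (pstar / p k)\<close> while \<open>S\<close> stays at least
  \<open>c ^ (t-1) * T i powr (pstar / p0)\<close>, where \<open>1 / p0 = (\<Sum>k<t. 1 / p k) + 1 / pstar\<close>.
  Only scalars in \<open>[0, 1]\<close> may be used, so a small factor \<open>c\<close> common to all \<open>i\<close> and \<open>k\<close> is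
  included; it cancels, because both sides of the summability inequality acquire the factor
  \<open>c ^ (t-1)\<close>. With \<open>N = (\<Sum>i. T i powr pstar)\<close> the inequality then reads
  \<open>N powr (1 / p0) \<le> C * N powr (1 / p0 - 1 / pstar) * W\<close>, which is the condition.
\<close>


section \<open>Hoelder's inequality with several factors\<close>

lemma weighted_arith_geom_mean:
  fixes \<theta> y :: "'k \<Rightarrow> real"
  assumes "finite K" and "\<And>k. k \<in> K \<Longrightarrow> 0 \<le> \<theta> k" and "(\<Sum>k\<in>K. \<theta> k) = 1"
    and y: "\<And>k. k \<in> K \<Longrightarrow> 0 \<le> y k"
  shows "(\<Prod>k\<in>K. y k powr \<theta> k) \<le> (\<Sum>k\<in>K. \<theta> k * y k)"
proof (cases "\<exists>k\<in>K. y k = 0")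
  case True
  then have "(\<Prod>k\<in>K. y k powr \<theta> k) = 0"
    using \<open>finite K\<close> by (auto intro: prod_zero)
  moreover have "0 \<le> (\<Sum>k\<in>K. \<theta> k * y k)"
    using assms by (intro sum_nonneg) auto
  ultimately show ?thesis
    by linarith
next
  case False
  with y have pos: "0 < y k" if "k \<in> K" for k
    using that by (metis less_eq_real_def)
  have "K \<noteq> {}"
    using assms(3) by auto
  have "(\<Prod>k\<in>K. y k powr \<theta> k) = exp (\<Sum>k\<in>K. \<theta> k *\<^sub>R ln (y k))"
    using \<open>finite K\<close> False by (auto simp: exp_sum powr_def intro!: prod.cong)
  also have "\<dots> \<le> (\<Sum>k\<in>K. \<theta> k * exp (ln (y k)))"
    by (rule convex_on_sum[OF \<open>finite K\<close> \<open>K \<noteq> {}\<close> exp_convex]) (use assms in auto)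
  also have "\<dots> = (\<Sum>k\<in>K. \<theta> k * y k)"
    using pos by (intro sum.cong) auto
  finally show ?thesis .
qed

text \<open>
  Once each family \<open>a k\<close> is divided by its sum, the weighted inequality of the means, summed
  over \<open>i\<close>, bounds the left-hand side by \<open>\<Sum>k\<in>K. \<theta> k = 1\<close>.
\<close>

lemma sum_prod_powr_le:
  fixes \<theta> :: "'k \<Rightarrow> real" and a :: "'k \<Rightarrow> 'i \<Rightarrow> real"
  assumes "finite I" "finite K" and \<theta>: "\<And>k. k \<in> K \<Longrightarrow> 0 \<le> \<theta> k" and "(\<Sum>k\<in>K. \<theta> k) = 1"
    and a: "\<And>k i. k \<in> K \<Longrightarrow> i \<in> I \<Longrightarrow> 0 \<le> a k i"
  shows "(\<Sum>i\<in>I. \<Prod>k\<in>K. a k i powr \<theta> k) \<le> (\<Prod>k\<in>K. (\<Sum>i\<in>I. a k i) powr \<theta> k)"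
proof (cases "\<exists>k\<in>K. (\<Sum>i\<in>I. a k i) = 0")
  case True
  then obtain k where k: "k \<in> K" "(\<Sum>i\<in>I. a k i) = 0"
    by blast
  then have "a k i = 0" if "i \<in> I" for i
    using that \<open>finite I\<close> a by (simp add: sum_nonneg_eq_0_iff)
  then have "(\<Prod>k\<in>K. a k i powr \<theta> k) = 0" if "i \<in> I" for i
    using that k \<open>finite K\<close> by (auto intro!: prod_zero)
  then have "(\<Sum>i\<in>I. \<Prod>k\<in>K. a k i powr \<theta> k) = 0"
    by simp
  then show ?thesis
    by (simp add: prod_nonneg)
next
  case False
  define A where "A k = (\<Sum>i\<in>I. a k i)" for k
  have A: "0 < A k" if "k \<in> K" for k
    using False that a by (metis A_def less_eq_real_def sum_nonneg)
  have "(\<Sum>i\<in>I. \<Prod>k\<in>K. a k i powr \<theta> k)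
      = (\<Sum>i\<in>I. (\<Prod>k\<in>K. A k powr \<theta> k) * (\<Prod>k\<in>K. (a k i / A k) powr \<theta> k))"
  proof (rule sum.cong[OF refl])
    fix i assume "i \<in> I"
    have "(\<Prod>k\<in>K. a k i powr \<theta> k) = (\<Prod>k\<in>K. A k powr \<theta> k * (a k i / A k) powr \<theta> k)"
      unfolding powr_mult[symmetric] by (intro prod.cong) (use A in force)+
    then show "(\<Prod>k\<in>K. a k i powr \<theta> k)
        = (\<Prod>k\<in>K. A k powr \<theta> k) * (\<Prod>k\<in>K. (a k i / A k) powr \<theta> k)"
      by (simp add: prod.distrib)
  qed
  also have "\<dots> \<le> (\<Sum>i\<in>I. (\<Prod>k\<in>K. A k powr \<theta> k) * (\<Sum>k\<in>K. \<theta> k * (a k i / A k)))"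
    using assms A
    by (intro sum_mono mult_left_mono weighted_arith_geom_mean prod_nonneg)
      (auto intro: divide_nonneg_pos)
  also have "\<dots> = (\<Prod>k\<in>K. A k powr \<theta> k) * (\<Sum>k\<in>K. \<Sum>i\<in>I. \<theta> k * (a k i / A k))"
    by (simp add: sum_distrib_left sum.swap[of _ I])
  also have "(\<Sum>k\<in>K. \<Sum>i\<in>I. \<theta> k * (a k i / A k)) = (\<Sum>k\<in>K. \<theta> k)"
  proof (rule sum.cong[OF refl])
    fix k assume "k \<in> K"
    have "(\<Sum>i\<in>I. \<theta> k * (a k i / A k)) = \<theta> k * ((\<Sum>i\<in>I. a k i) / A k)"
      by (simp add: sum_distrib_left sum_divide_distrib)
    with A[OF \<open>k \<in> K\<close>] show "(\<Sum>i\<in>I. \<theta> k * (a k i / A k)) = \<theta> k"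
      by (simp flip: A_def)
  qed
  finally show ?thesis
    using assms by (simp add: A_def)
qed

lemma Hoelder_sum_prod:
  fixes p :: "'k \<Rightarrow> real" and a :: "'k \<Rightarrow> 'i \<Rightarrow> real"
  assumes "finite I" "finite K" and p: "\<And>k. k \<in> K \<Longrightarrow> 0 < p k"
    and "0 < s" and s: "1 / s = (\<Sum>k\<in>K. 1 / p k)"
    and a: "\<And>k i. k \<in> K \<Longrightarrow> i \<in> I \<Longrightarrow> 0 \<le> a k i"
  shows "(\<Sum>i\<in>I. (\<Prod>k\<in>K. a k i) powr s) powr (1 / s)
      \<le> (\<Prod>k\<in>K. (\<Sum>i\<in>I. a k i powr p k) powr (1 / p k))"
proof -
  have "(\<Sum>k\<in>K. s / p k) = s * (\<Sum>k\<in>K. 1 / p k)"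
    by (simp add: sum_distrib_left)
  also have "\<dots> = 1"
    using \<open>0 < s\<close> by (simp flip: s)
  finally have one: "(\<Sum>k\<in>K. s / p k) = 1" .
  have "(\<Sum>i\<in>I. (\<Prod>k\<in>K. a k i) powr s) = (\<Sum>i\<in>I. \<Prod>k\<in>K. (a k i powr p k) powr (s / p k))"
    using p by (intro sum.cong) (auto simp: prod_powr_distrib powr_powr intro!: prod.cong dest: p)
  also have "\<dots> \<le> (\<Prod>k\<in>K. (\<Sum>i\<in>I. a k i powr p k) powr (s / p k))"
    using assms(1,2) p \<open>0 < s\<close> one by (intro sum_prod_powr_le) (auto intro: less_imp_le)
  finally have "(\<Sum>i\<in>I. (\<Prod>k\<in>K. a k i) powr s) powr (1 / s)
      \<le> (\<Prod>k\<in>K. (\<Sum>i\<in>I. a k i powr p k) powr (s / p k)) powr (1 / s)"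
    using \<open>0 < s\<close> by (intro powr_mono2) (auto intro: sum_nonneg)
  also have "\<dots> = (\<Prod>k\<in>K. (\<Sum>i\<in>I. a k i powr p k) powr (1 / p k))"
    using \<open>0 < s\<close> by (simp add: prod_powr_distrib powr_powr)
  finally show ?thesis .
qed


section \<open>Abstract summability when all but the last \<open>R k\<close> are constant\<close>

locale constant_but_last =
  fixes r t :: nat and E :: "nat \<Rightarrow> 'e set" and K :: "nat \<Rightarrow> 'k topology"
    and G :: "nat \<Rightarrow> ('a::real_normed_field, 'g, 'm) normed_module_scheme"
    and R :: "nat \<Rightarrow> 'k \<Rightarrow> (nat \<Rightarrow> 'e) \<Rightarrow> 'g \<Rightarrow> real"
    and S :: "'f \<Rightarrow> (nat \<Rightarrow> 'e) \<Rightarrow> (nat \<Rightarrow> 'g) \<Rightarrow> real"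
    and f :: 'f
  assumes t: "1 \<le> t"
    and K_nonempty: "\<And>k. k \<in> {1..t} \<Longrightarrow> topspace (K k) \<noteq> {}"
    and K_compact: "compact_space (K t)"
    and smult_closed: "\<And>k c b. \<lbrakk>k \<in> {1..t}; b \<in> carrier (G k)\<rbrakk> \<Longrightarrow> c \<odot>\<^bsub>G k\<^esub> b \<in> carrier (G k)"
    and R_nonneg: "\<And>k \<phi> x b. \<lbrakk>k \<in> {1..t}; \<phi> \<in> topspace (K k);
           x \<in> (\<Pi>\<^sub>E l\<in>{1..r}. E l); b \<in> carrier (G k)\<rbrakk> \<Longrightarrow> 0 \<le> R k \<phi> x b"
    and S_nonneg: "\<And>x b. \<lbrakk>x \<in> (\<Pi>\<^sub>E l\<in>{1..r}. E l); b \<in> (\<Pi>\<^sub>E k\<in>{1..t}. carrier (G k))\<rbrakk>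
           \<Longrightarrow> 0 \<le> S f x b"
    and R_continuous: "\<And>x b. \<lbrakk>x \<in> (\<Pi>\<^sub>E l\<in>{1..r}. E l); b \<in> carrier (G t)\<rbrakk>
           \<Longrightarrow> continuous_map (K t) euclideanreal (\<lambda>\<phi>. R t \<phi> x b)"
    and R_scale: "\<And>k \<phi> x b \<eta>. \<lbrakk>k \<in> {1..t}; \<phi> \<in> topspace (K k);
           x \<in> (\<Pi>\<^sub>E l\<in>{1..r}. E l); b \<in> carrier (G k); 0 \<le> \<eta>; \<eta> \<le> 1\<rbrakk>
           \<Longrightarrow> R k \<phi> x (of_real \<eta> \<odot>\<^bsub>G k\<^esub> b) \<le> \<eta> * R k \<phi> x b"
    and S_scale: "\<And>x b \<alpha>. \<lbrakk>x \<in> (\<Pi>\<^sub>E l\<in>{1..r}. E l); b \<in> (\<Pi>\<^sub>E k\<in>{1..t}. carrier (G k));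
           \<And>k. k \<in> {1..t} \<Longrightarrow> 0 \<le> \<alpha> k \<and> \<alpha> k \<le> 1\<rbrakk>
           \<Longrightarrow> (\<Prod>k=1..t. \<alpha> k) * S f x b \<le> S f x (\<lambda>k\<in>{1..t}. of_real (\<alpha> k) \<odot>\<^bsub>G k\<^esub> b k)"
    and R_constant: "\<And>k x b. \<lbrakk>k \<in> {1..t-1}; x \<in> (\<Pi>\<^sub>E l\<in>{1..r}. E l); b \<in> carrier (G k)\<rbrakk>
           \<Longrightarrow> (\<lambda>\<phi>. R k \<phi> x b) constant_on topspace (K k)"
begin

definition \<rho> :: "nat \<Rightarrow> (nat \<Rightarrow> 'e) \<Rightarrow> 'g \<Rightarrow> real" where
  "\<rho> k x b = R k (SOME \<phi>. \<phi> \<in> topspace (K k)) x b"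

definition admissible :: "nat \<Rightarrow> (nat \<Rightarrow> nat \<Rightarrow> 'e) \<Rightarrow> (nat \<Rightarrow> nat \<Rightarrow> 'g) \<Rightarrow> bool" where
  "admissible m x b \<longleftrightarrow> (\<forall>i\<in>{1..m}. x i \<in> (\<Pi>\<^sub>E l\<in>{1..r}. E l)) \<and>
     (\<forall>i\<in>{1..m}. b i \<in> (\<Pi>\<^sub>E k\<in>{1..t}. carrier (G k)))"

definition weak_norm :: "real \<Rightarrow> nat \<Rightarrow> (nat \<Rightarrow> nat \<Rightarrow> 'e) \<Rightarrow> (nat \<Rightarrow> 'g) \<Rightarrow> real" where
  "weak_norm P m x y =
     (SUP \<phi>\<in>topspace (K t). (\<Sum>i=1..m. R t \<phi> (x i) (y i) powr P) powr (1 / P))"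

text \<open>
  A vanishing product in the denominator makes the quotient \<open>0\<close>, so the inequality alone would
  say nothing about \<open>S\<close> at such an index. Hence the first conjunct.
\<close>

definition normalized_summing :: "real \<Rightarrow> bool" where
  "normalized_summing P \<longleftrightarrow> (\<exists>C>0. \<forall>m x b. admissible m x b \<longrightarrow>
     (\<forall>i\<in>{1..m}. (\<Prod>k=1..t-1. \<rho> k (x i) (b i k)) = 0 \<longrightarrow> S f (x i) (b i) = 0) \<and>
     (\<Sum>i=1..m. (S f (x i) (b i) / (\<Prod>k=1..t-1. \<rho> k (x i) (b i k))) powr P) powr (1 / P)
       \<le> C * weak_norm P m x (\<lambda>i. b i t))"

lemma split_last: "{1..t} = insert t {1..t-1}" "t \<notin> {1..t-1}" "t \<in> {1..t}"
  using t by auto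

lemma R_eq_\<rho>:
  assumes "k \<in> {1..t-1}" "\<phi> \<in> topspace (K k)" "x \<in> (\<Pi>\<^sub>E l\<in>{1..r}. E l)" "b \<in> carrier (G k)"
  shows "R k \<phi> x b = \<rho> k x b"
proof -
  have "(SOME \<phi>. \<phi> \<in> topspace (K k)) \<in> topspace (K k)"
    using assms(2) by (rule someI)
  with R_constant[OF assms(1,3,4)] assms(2) show ?thesis
    by (auto simp: \<rho>_def constant_on_def)
qed

lemma \<rho>_nonneg:
  assumes "k \<in> {1..t-1}" "x \<in> (\<Pi>\<^sub>E l\<in>{1..r}. E l)" "b \<in> carrier (G k)"
  shows "0 \<le> \<rho> k x b"
proof -
  have k: "k \<in> {1..t}"
    using assms(1) by auto
  then obtain \<phi> where "\<phi> \<in> topspace (K k)"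
    using K_nonempty by blast
  then show ?thesis
    using R_nonneg[OF k] R_eq_\<rho> assms by metis
qed

lemma \<rho>_scale:
  assumes "k \<in> {1..t-1}" "x \<in> (\<Pi>\<^sub>E l\<in>{1..r}. E l)" "b \<in> carrier (G k)" "0 \<le> \<eta>" "\<eta> \<le> 1"
  shows "\<rho> k x (of_real \<eta> \<odot>\<^bsub>G k\<^esub> b) \<le> \<eta> * \<rho> k x b"
proof -
  have k: "k \<in> {1..t}"
    using assms(1) by auto
  then obtain \<phi> where \<phi>: "\<phi> \<in> topspace (K k)"
    using K_nonempty by blast
  show ?thesis
    using R_scale[OF k \<phi> assms(2-5)] R_eq_\<rho>[OF assms(1) \<phi> assms(2)] smult_closed[OF k] assms(3)
    by metis
qed

text \<open>Compactness makes the supremum finite, which is what makes it monotone in the summands.\<close>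

lemma bdd_above_weak_norm:
  assumes adm: "admissible m x b" and "0 < P"
  shows "bdd_above ((\<lambda>\<phi>. (\<Sum>i=1..m. R t \<phi> (x i) (b i t) powr P) powr (1 / P)) ` topspace (K t))"
proof -
  have "\<exists>B. \<forall>\<phi>\<in>topspace (K t). R t \<phi> (x i) (b i t) \<le> B" if "i \<in> {1..m}" for i
  proof -
    have "x i \<in> (\<Pi>\<^sub>E l\<in>{1..r}. E l)" "b i t \<in> carrier (G t)"
      using adm that split_last(3) by (auto simp: admissible_def simp del: atLeastAtMost_iff)
    then have "compactin euclideanreal ((\<lambda>\<phi>. R t \<phi> (x i) (b i t)) ` topspace (K t))"
      using K_compact R_continuous image_compactin compact_space_def by metis
    then have "bdd_above ((\<lambda>\<phi>. R t \<phi> (x i) (b i t)) ` topspace (K t))"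
      by (simp add: compact_imp_bounded bounded_imp_bdd_above)
    then show ?thesis
      by (auto simp: bdd_above_def)
  qed
  then obtain B where B: "\<And>i \<phi>. i \<in> {1..m} \<Longrightarrow> \<phi> \<in> topspace (K t) \<Longrightarrow> R t \<phi> (x i) (b i t) \<le> B i"
    by metis
  show ?thesis
  proof (rule bdd_aboveI2)
    fix \<phi> assume "\<phi> \<in> topspace (K t)"
    then show "(\<Sum>i=1..m. R t \<phi> (x i) (b i t) powr P) powr (1 / P)
        \<le> (\<Sum>i=1..m. B i powr P) powr (1 / P)"
      using B R_nonneg adm split_last(3) \<open>0 < P\<close>
      by (intro powr_mono2 sum_mono sum_nonneg)
        (auto simp: admissible_def PiE_iff simp del: atLeastAtMost_iff)
  qed
qed

lemma weak_norm_nonneg: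
  assumes "admissible m x b" and "0 < P"
  shows "0 \<le> weak_norm P m x (\<lambda>i. b i t)"
proof -
  obtain \<phi> where "\<phi> \<in> topspace (K t)"
    using K_nonempty split_last(3) by blast
  then have "(\<Sum>i=1..m. R t \<phi> (x i) (b i t) powr P) powr (1 / P) \<le> weak_norm P m x (\<lambda>i. b i t)"
    unfolding weak_norm_def by (intro cSUP_upper bdd_above_weak_norm assms)
  then show ?thesis
    by (meson order_trans powr_ge_zero)
qed

text \<open>
  For \<open>k < t\<close> the supremum runs over a constant function, so it can be dropped.
\<close>

lemma abstract_summing_iff:
  assumes p: "\<And>k. k \<in> {1..t} \<Longrightarrow> 0 < p k"
  shows "abstract_summing r t E K G R S p f \<longleftrightarrow>
     (\<exists>p0>0. 1 / p0 = (\<Sum>k=1..t-1. 1 / p k) + 1 / p t \<and>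
       (\<exists>C>0. \<forall>m x b. admissible m x b \<longrightarrow>
          (\<Sum>i=1..m. S f (x i) (b i) powr p0) powr (1 / p0)
          \<le> C * ((\<Prod>k=1..t-1. (\<Sum>i=1..m. \<rho> k (x i) (b i k) powr p k) powr (1 / p k))
                  * weak_norm (p t) m x (\<lambda>i. b i t))))"
proof -
  have sum: "(\<Sum>k=1..t. 1 / p k) = (\<Sum>k=1..t-1. 1 / p k) + 1 / p t"
    using split_last by simp
  have prod: "(\<Prod>k=1..t. SUP \<phi>\<in>topspace (K k).
          (\<Sum>i=1..m. R k \<phi> (x i) (b i k) powr p k) powr (1 / p k))
      = (\<Prod>k=1..t-1. (\<Sum>i=1..m. \<rho> k (x i) (b i k) powr p k) powr (1 / p k))
          * weak_norm (p t) m x (\<lambda>i. b i t)" if adm: "admissible m x b" for m x b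
  proof -
    have "(SUP \<phi>\<in>topspace (K k). (\<Sum>i=1..m. R k \<phi> (x i) (b i k) powr p k) powr (1 / p k))
        = (\<Sum>i=1..m. \<rho> k (x i) (b i k) powr p k) powr (1 / p k)" if k: "k \<in> {1..t-1}" for k
    proof -
      have k': "k \<in> {1..t}"
        using k by auto
      have "(SUP \<phi>\<in>topspace (K k). (\<Sum>i=1..m. R k \<phi> (x i) (b i k) powr p k) powr (1 / p k))
         = (SUP \<phi>\<in>topspace (K k). (\<Sum>i=1..m. \<rho> k (x i) (b i k) powr p k) powr (1 / p k))"
        using adm k' by (intro SUP_cong refl arg_cong2[of _ _ _ _ "(powr)"] sum.cong R_eq_\<rho>[OF k])
          (auto simp: admissible_def PiE_iff simp del: atLeastAtMost_iff)
      then show ?thesis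
        using K_nonempty[OF k'] by simp
    qed
    then show ?thesis
      using split_last by (simp add: weak_norm_def mult.commute)
  qed
  have pos: "(\<forall>k\<in>{1..t}. 0 < p k) = True"
    using p by simp
  show ?thesis
    unfolding abstract_summing_def sum imp_conjL[symmetric] admissible_def[symmetric]
    by (simp only: pos prod simp_thms cong: imp_cong)
qed

lemma admissibleD:
  assumes "admissible m x b" "i \<in> {1..m}"
  shows "x i \<in> (\<Pi>\<^sub>E l\<in>{1..r}. E l)" "b i \<in> (\<Pi>\<^sub>E k\<in>{1..t}. carrier (G k))"
    "k \<in> {1..t} \<Longrightarrow> b i k \<in> carrier (G k)" "k \<in> {1..t-1} \<Longrightarrow> b i k \<in> carrier (G k)"
proof -
  show b: "b i \<in> (\<Pi>\<^sub>E k\<in>{1..t}. carrier (G k))" and "x i \<in> (\<Pi>\<^sub>E l\<in>{1..r}. E l)"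
    using assms by (auto simp: admissible_def simp del: atLeastAtMost_iff)
  then show *: "b i k \<in> carrier (G k)" if "k \<in> {1..t}"
    using that by (auto simp: PiE_iff)
  then show "b i k \<in> carrier (G k)" if "k \<in> {1..t-1}"
    using that by auto
qed

text \<open>Hoelder's inequality is applied to the families \<open>\<rho> k (x i) (b i k)\<close> with \<open>k < t\<close> and \<open>T\<close>.\<close>

lemma normalized_summing_imp_abstract_summing:
  assumes p: "\<And>k. k \<in> {1..t} \<Longrightarrow> 0 < p k" and norm: "normalized_summing (p t)"
  shows "abstract_summing r t E K G R S p f"
proof -
  define p0 where "p0 = 1 / (\<Sum>k\<in>{1..t}. 1 / p k)"
  have "0 < (\<Sum>k\<in>{1..t}. 1 / p k)"
    using p split_last(3) by (intro sum_pos) auto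
  then have p0: "0 < p0" "1 / p0 = (\<Sum>k\<in>{1..t}. 1 / p k)"
    by (auto simp: p0_def)
  obtain C where "0 < C"
    and vanish: "\<And>m x b i. admissible m x b \<Longrightarrow> i \<in> {1..m} \<Longrightarrow>
      (\<Prod>k=1..t-1. \<rho> k (x i) (b i k)) = 0 \<Longrightarrow> S f (x i) (b i) = 0"
    and C: "\<And>m x b. admissible m x b \<Longrightarrow>
      (\<Sum>i=1..m. (S f (x i) (b i) / (\<Prod>k=1..t-1. \<rho> k (x i) (b i k))) powr p t) powr (1 / p t)
        \<le> C * weak_norm (p t) m x (\<lambda>i. b i t)"
    using norm unfolding normalized_summing_def by blast
  have "(\<Sum>i=1..m. S f (x i) (b i) powr p0) powr (1 / p0)
          \<le> C * ((\<Prod>k=1..t-1. (\<Sum>i=1..m. \<rho> k (x i) (b i k) powr p k) powr (1 / p k))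
                  * weak_norm (p t) m x (\<lambda>i. b i t))" if adm: "admissible m x b" for m x b
  proof -
    define T where "T i = S f (x i) (b i) / (\<Prod>k=1..t-1. \<rho> k (x i) (b i k))" for i
    define a where "a k i = (if k = t then T i else \<rho> k (x i) (b i k))" for k i
    note admD = admissibleD[OF adm]
    have T: "0 \<le> T i" if "i \<in> {1..m}" for i
      unfolding T_def using admD[OF that]
      by (intro divide_nonneg_nonneg prod_nonneg \<rho>_nonneg S_nonneg) auto
    have a: "0 \<le> a k i" if "k \<in> {1..t}" "i \<in> {1..m}" for k i
      using T[OF that(2)] admD(1)[OF that(2)] admD(4)[OF that(2)] \<rho>_nonneg that(1) split_last(1)
      by (auto simp: a_def simp del: atLeastAtMost_iff)
    have prod_a: "(\<Prod>k\<in>{1..t}. g (a k) k) = (\<Prod>k=1..t-1. g (\<lambda>i. \<rho> k (x i) (b i k)) k) * g T t"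
      for g :: "(nat \<Rightarrow> real) \<Rightarrow> nat \<Rightarrow> real"
    proof -
      have "a k = (\<lambda>i. \<rho> k (x i) (b i k))" if "k \<in> {1..t-1}" for k
        using that split_last(2) by (auto simp: a_def)
      then have "(\<Prod>k=1..t-1. g (a k) k) = (\<Prod>k=1..t-1. g (\<lambda>i. \<rho> k (x i) (b i k)) k)"
        by (intro prod.cong refl) simp
      moreover have "a t = T"
        by (auto simp: a_def)
      ultimately show ?thesis
        using split_last by (simp add: mult.commute)
    qed
    have "(\<Sum>i=1..m. S f (x i) (b i) powr p0) = (\<Sum>i=1..m. (\<Prod>k\<in>{1..t}. a k i) powr p0)"
      using vanish[OF adm] prod_a[of "\<lambda>h _. h _"]
      by (intro sum.cong) (auto simp: T_def simp del: atLeastAtMost_iff)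
    then have "(\<Sum>i=1..m. S f (x i) (b i) powr p0) powr (1 / p0)
        = (\<Sum>i=1..m. (\<Prod>k\<in>{1..t}. a k i) powr p0) powr (1 / p0)"
      by simp
    also have "\<dots> \<le> (\<Prod>k\<in>{1..t}. (\<Sum>i=1..m. a k i powr p k) powr (1 / p k))"
      using p p0 a by (intro Hoelder_sum_prod finite_atLeastAtMost)
    also have "\<dots> = (\<Prod>k=1..t-1. (\<Sum>i=1..m. \<rho> k (x i) (b i k) powr p k) powr (1 / p k))
        * (\<Sum>i=1..m. T i powr p t) powr (1 / p t)"
      by (rule prod_a)
    also have "\<dots> \<le> (\<Prod>k=1..t-1. (\<Sum>i=1..m. \<rho> k (x i) (b i k) powr p k) powr (1 / p k))
        * (C * weak_norm (p t) m x (\<lambda>i. b i t))"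
      using C[OF adm] unfolding T_def by (intro mult_left_mono prod_nonneg) auto
    finally show ?thesis
      by (simp add: mult_ac)
  qed
  moreover have "1 / p0 = (\<Sum>k=1..t-1. 1 / p k) + 1 / p t"
    using p0(2) split_last by simp
  ultimately show ?thesis
    using abstract_summing_iff[of p] p \<open>0 < C\<close> p0(1) by blast
qed

text \<open>
  The summability inequality is tested on \<open>\<alpha> i k \<cdot> b i k\<close> in place of \<open>b i k\<close>, where
  \<open>\<alpha> i t = 1\<close> and \<open>\<alpha> i k = c * T i powr (p t / p k) / \<rho> k (x i) (b i k)\<close> for \<open>k < t\<close>. These
  exponents make the sums \<open>\<Sum>i. T i powr p t\<close> appear in every factor, and they add up to the
  right power on the left since \<open>p t / p0 = (\<Sum>k<t. p t / p k) + 1\<close>.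
\<close>

lemma abstract_summing_imp_normalized_summing:
  assumes p: "\<And>k. k \<in> {1..t} \<Longrightarrow> 0 < p k" and summing: "abstract_summing r t E K G R S p f"
  shows "normalized_summing (p t)"
proof -
  obtain p0 C where p0: "0 < p0" "1 / p0 = (\<Sum>k=1..t-1. 1 / p k) + 1 / p t" and "0 < C"
    and C: "\<And>m x b. admissible m x b \<Longrightarrow> (\<Sum>i=1..m. S f (x i) (b i) powr p0) powr (1 / p0)
          \<le> C * ((\<Prod>k=1..t-1. (\<Sum>i=1..m. \<rho> k (x i) (b i k) powr p k) powr (1 / p k))
                  * weak_norm (p t) m x (\<lambda>i. b i t))"
    using abstract_summing_iff[of p] p summing by blast
  define P where "P = p t"
  have P: "0 < P"
    using p split_last(3) by (simp add: P_def)
  have pk: "0 < p k" if "k \<in> {1..t-1}" for k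
    using that by (intro p) auto
  have vanish: "S f (x i) (b i) = 0"
    if adm: "admissible m x b" and i: "i \<in> {1..m}"
      and zero: "(\<Prod>k=1..t-1. \<rho> k (x i) (b i k)) = 0" for m x b i
  proof -
    \<comment> \<open>A family with the single index \<open>i\<close> has a vanishing right-hand side.\<close>
    obtain k where k: "k \<in> {1..t-1}" "\<rho> k (x i) (b i k) = 0"
      using zero by (auto simp: prod_zero_iff)
    have "admissible 1 (\<lambda>_. x i) (\<lambda>_. b i)"
      using admissibleD(1,2)[OF adm i] by (simp add: admissible_def)
    from C[OF this] have "(S f (x i) (b i) powr p0) powr (1 / p0)
      \<le> C * ((\<Prod>k=1..t-1. (\<rho> k (x i) (b i k) powr p k) powr (1 / p k))
                  * weak_norm (p t) 1 (\<lambda>_. x i) (\<lambda>_. b i t))"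
      by simp
    also have "(\<Prod>k=1..t-1. (\<rho> k (x i) (b i k) powr p k) powr (1 / p k)) = 0"
      using k by (intro prod_zero) auto
    finally show ?thesis
      using S_nonneg[OF admissibleD(1,2)[OF adm i]] p0(1) by (simp add: powr_powr)
  qed
  have "(\<Sum>i=1..m. (S f (x i) (b i) / (\<Prod>k=1..t-1. \<rho> k (x i) (b i k))) powr P) powr (1 / P)
      \<le> C * weak_norm P m x (\<lambda>i. b i t)" if adm: "admissible m x b" for m x b
  proof -
    define T where "T i = S f (x i) (b i) / (\<Prod>k=1..t-1. \<rho> k (x i) (b i k))" for i
    define N where "N = (\<Sum>i=1..m. T i powr P)"
    define W where "W = weak_norm P m x (\<lambda>i. b i t)"
    note admD = admissibleD[OF adm]
    have \<rho>: "0 \<le> \<rho> k (x i) (b i k)" if "k \<in> {1..t-1}" "i \<in> {1..m}" for k i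
      using admD[OF that(2)] that(1) by (intro \<rho>_nonneg) auto
    have T: "0 \<le> T i" if "i \<in> {1..m}" for i
      unfolding T_def using admD[OF that] \<rho> that
      by (intro divide_nonneg_nonneg prod_nonneg S_nonneg) auto
    have W: "0 \<le> W"
      unfolding W_def using adm P by (rule weak_norm_nonneg)
    have "N powr (1 / P) \<le> C * W"
    proof (cases "N = 0")
      case True
      then show ?thesis
        using \<open>0 < C\<close> W by simp
    next
      case False
      then have N: "0 < N"
        by (metis N_def less_eq_real_def powr_ge_zero sum_nonneg)
      define \<mu> where "\<mu> k i = T i powr (P / p k) / \<rho> k (x i) (b i k)" for k i
      have \<mu>: "0 \<le> \<mu> k i" if "k \<in> {1..t-1}" "i \<in> {1..m}" for k i
        using \<rho>[OF that] by (simp add: \<mu>_def)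
      \<comment> \<open>The sum dominates each \<open>\<mu> k i\<close>, so \<open>c * \<mu> k i\<close> is an admissible scalar.\<close>
      define c where "c = 1 / (1 + (\<Sum>k=1..t-1. \<Sum>i=1..m. \<mu> k i))"
      have sum_\<mu>: "0 \<le> (\<Sum>k=1..t-1. \<Sum>i=1..m. \<mu> k i)"
        using \<mu> by (intro sum_nonneg) auto
      then have c: "0 < c"
        by (simp add: c_def)
      have c\<mu>: "c * \<mu> k i \<le> 1" if "k \<in> {1..t-1}" "i \<in> {1..m}" for k i
      proof -
        have "\<mu> k i \<le> (\<Sum>i=1..m. \<mu> k i)"
          using that \<mu> by (intro member_le_sum) auto
        also have "\<dots> \<le> (\<Sum>k=1..t-1. \<Sum>i=1..m. \<mu> k i)"
          using that \<mu> by (intro member_le_sum[of _ _ "\<lambda>k. \<Sum>i=1..m. \<mu> k i"] sum_nonneg) auto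
        finally show ?thesis
          using sum_\<mu> by (simp add: c_def)
      qed
      define \<alpha> where "\<alpha> i k = (if k = t then 1 else c * \<mu> k i)" for i k
      have \<alpha>: "0 \<le> \<alpha> i k \<and> \<alpha> i k \<le> 1" if "k \<in> {1..t}" "i \<in> {1..m}" for k i
        using \<mu>[of k i] c\<mu>[of k i] c that split_last(1)
        by (auto simp: \<alpha>_def simp del: atLeastAtMost_iff)
      have \<alpha>_k: "\<alpha> i k = c * \<mu> k i" if "k \<in> {1..t-1}" for i k
        using that split_last(2) by (auto simp: \<alpha>_def)
      define d where "d i = (\<lambda>k\<in>{1..t}. of_real (\<alpha> i k) \<odot>\<^bsub>G k\<^esub> b i k)" for i
      have adm': "admissible m x d"
        using adm smult_closed admD(3) by (auto simp: admissible_def d_def)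
      have \<rho>_d: "\<rho> k (x i) (d i k) \<le> c * T i powr (P / p k)" if k: "k \<in> {1..t-1}" and i: "i \<in> {1..m}"
        for k i
      proof -
        have k': "k \<in> {1..t}"
          using k by auto
        have "\<rho> k (x i) (d i k) \<le> \<alpha> i k * \<rho> k (x i) (b i k)"
          using \<rho>_scale[OF k admD(1,4)[OF i] ] \<alpha>[OF k' i] k k' by (simp add: d_def)
        also have "\<dots> \<le> c * T i powr (P / p k)"
          using c by (auto simp: \<alpha>_k[OF k] \<mu>_def)
        finally show ?thesis .
      qed
      have S_d: "c ^ (t-1) * T i powr (P / p0) \<le> S f (x i) (d i)" if i: "i \<in> {1..m}" for i
      proof -
        have "c ^ (t-1) * T i powr (P / p0) = (\<Prod>k=1..t. \<alpha> i k) * S f (x i) (b i)"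
        proof (cases "S f (x i) (b i) = 0")
          case True
          then show ?thesis
            by (simp add: T_def)
        next
          case False
          then have nz: "(\<Prod>k=1..t-1. \<rho> k (x i) (b i k)) \<noteq> 0"
            using vanish[OF adm i] by blast
          then have "T i \<noteq> 0"
            using False by (auto simp: T_def)
          have "P / p0 = P * (1 / p0)"
            by simp
          also have "\<dots> = (\<Sum>k=1..t-1. P / p k) + 1"
            unfolding p0(2) using P by (simp add: P_def distrib_left sum_distrib_left)
          finally have "P / p0 = (\<Sum>k=1..t-1. P / p k) + 1" .
          then have "T i powr (P / p0) = (\<Prod>k=1..t-1. T i powr (P / p k)) * T i"
            using \<open>T i \<noteq> 0\<close> T[OF i] by (simp add: powr_add powr_sum)
          moreover have "(\<Prod>k=1..t. \<alpha> i k) = (\<Prod>k=1..t-1. \<alpha> i k)"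
            using split_last by (simp add: \<alpha>_def)
          moreover have "(\<Prod>k=1..t-1. \<alpha> i k) = (\<Prod>k=1..t-1. c * \<mu> k i)"
            by (intro prod.cong refl \<alpha>_k)
          ultimately show ?thesis
            by (simp add: prod.distrib \<mu>_def prod_dividef T_def)
        qed
        also have "\<dots> \<le> S f (x i) (d i)"
          unfolding d_def using \<alpha> i by (intro S_scale admD) auto
        finally show ?thesis .
      qed
      have W_d: "weak_norm P m x (\<lambda>i. d i t) \<le> W"
        unfolding weak_norm_def W_def
      proof (rule cSUP_mono[OF K_nonempty[OF split_last(3)] bdd_above_weak_norm[OF adm P]])
        fix \<phi> assume \<phi>: "\<phi> \<in> topspace (K t)"
        \<comment> \<open>The scaling hypothesis at \<open>\<eta> = 1\<close> compares \<open>d i t = 1 \<cdot> b i t\<close> with \<open>b i t\<close>.\<close>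
        have "0 \<le> R t \<phi> (x i) (d i t) \<and> R t \<phi> (x i) (d i t) \<le> R t \<phi> (x i) (b i t)"
          if i: "i \<in> {1..m}" for i
          using R_scale[OF split_last(3) \<phi> admD(1,3)[OF i], of 1]
            R_nonneg[OF split_last(3) \<phi> admD(1)[OF i] admissibleD(3)[OF adm' i]] split_last(3)
          by (simp add: d_def \<alpha>_def)
        then show "\<exists>\<psi>\<in>topspace (K t). (\<Sum>i=1..m. R t \<phi> (x i) (d i t) powr P) powr (1 / P)
            \<le> (\<Sum>i=1..m. R t \<psi> (x i) (b i t) powr P) powr (1 / P)"
          using P by (intro bexI[OF _ \<phi>] powr_mono2 sum_mono sum_nonneg) auto
      qed
      have pow: "(\<Sum>i=1..m. (a * T i powr (P / w)) powr w) powr (1 / w) = a * N powr (1 / w)"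
        if "0 < a" "0 < w" for a w
      proof -
        have "(\<Sum>i=1..m. (a * T i powr (P / w)) powr w) = a powr w * N"
          using that by (simp add: powr_mult powr_powr N_def sum_distrib_left)
        then show ?thesis
          using that by (simp add: powr_mult powr_powr)
      qed
      have "c ^ (t-1) * N powr (1 / p0)
          = (\<Sum>i=1..m. (c ^ (t-1) * T i powr (P / p0)) powr p0) powr (1 / p0)"
        using pow[of "c ^ (t-1)" p0] c p0(1) by simp
      also have "\<dots> \<le> (\<Sum>i=1..m. S f (x i) (d i) powr p0) powr (1 / p0)"
        using S_d c p0(1) by (intro powr_mono2 sum_mono sum_nonneg) auto
      also have "\<dots> \<le> C * ((\<Prod>k=1..t-1. (\<Sum>i=1..m. \<rho> k (x i) (d i k) powr p k) powr (1 / p k))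
            * weak_norm P m x (\<lambda>i. d i t))"
        using C[OF adm'] by (simp add: P_def)
      also have "\<dots> \<le> C * ((\<Prod>k=1..t-1. c * N powr (1 / p k)) * W)"
      proof (intro mult_left_mono mult_mono prod_mono conjI)
        fix k assume k: "k \<in> {1..t-1}"
        have "(\<Sum>i=1..m. \<rho> k (x i) (d i k) powr p k) powr (1 / p k)
            \<le> (\<Sum>i=1..m. (c * T i powr (P / p k)) powr p k) powr (1 / p k)"
          using \<rho>_d[OF k] \<rho>_nonneg[OF k] admissibleD(1,4)[OF adm'] k pk[OF k]
          by (intro powr_mono2 sum_mono sum_nonneg) auto
        then show "(\<Sum>i=1..m. \<rho> k (x i) (d i k) powr p k) powr (1 / p k) \<le> c * N powr (1 / p k)"
          using pow[OF c pk[OF k]] by simp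
      qed (use W_d weak_norm_nonneg[OF adm' P] \<open>0 < C\<close> c in \<open>auto intro: prod_nonneg\<close>)
      also have "(\<Prod>k=1..t-1. c * N powr (1 / p k)) = c ^ (t-1) * N powr (\<Sum>k=1..t-1. 1 / p k)"
        using N by (simp add: prod.distrib powr_sum)
      also have "N powr (1 / p0) = N powr (\<Sum>k=1..t-1. 1 / p k) * N powr (1 / P)"
        unfolding p0(2) P_def by (rule powr_add)
      finally have "(c ^ (t-1) * N powr (\<Sum>k=1..t-1. 1 / p k)) * N powr (1 / P)
          \<le> (c ^ (t-1) * N powr (\<Sum>k=1..t-1. 1 / p k)) * (C * W)"
        by (simp add: mult_ac)
      then show ?thesis
        using c N by (simp add: mult_le_cancel_left)
    qed
    then show ?thesis
      by (simp add: N_def T_def W_def)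
  qed
  with vanish \<open>0 < C\<close> show ?thesis
    unfolding normalized_summing_def P_def by blast
qed

theorem abstract_summing_iff_normalized_summing:
  assumes "\<And>k. k \<in> {1..t} \<Longrightarrow> 0 < p k"
  shows "abstract_summing r t E K G R S p f \<longleftrightarrow> normalized_summing (p t)"
  using assms abstract_summing_imp_normalized_summing normalized_summing_imp_abstract_summing
  by blast

end


section \<open>Independence of the other exponents\<close>

text \<open>
  With the value at \<open>t\<close> fixed to \<open>pstar\<close>, both sides are the normalized condition for \<open>pstar\<close>.
\<close>

theorem theorem3p9:
  fixes t n r :: nat
    and Xs :: "nat \<Rightarrow> 'x set" and Y :: "'y set" and E :: "nat \<Rightarrow> 'e set"
    and \<H> :: "((nat \<Rightarrow> 'x) \<Rightarrow> 'y) set"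
    and K :: "nat \<Rightarrow> 'k topology"
    and G :: "nat \<Rightarrow> ('a::real_normed_field, 'g) normed_module"
    and R :: "nat \<Rightarrow> 'k \<Rightarrow> (nat \<Rightarrow> 'e) \<Rightarrow> 'g \<Rightarrow> real"
    and S :: "((nat \<Rightarrow> 'x) \<Rightarrow> 'y) \<Rightarrow> (nat \<Rightarrow> 'e) \<Rightarrow> (nat \<Rightarrow> 'g) \<Rightarrow> real"
    and f :: "(nat \<Rightarrow> 'x) \<Rightarrow> 'y"
    and pstar u s :: real and p q :: "nat \<Rightarrow> real"
  assumes "t \<ge> 2" and "n \<ge> 1" and "r \<ge> 1"
    and "\<And>i. i \<in> {1..n} \<Longrightarrow> Xs i \<noteq> {}" and "Y \<noteq> {}"
    and "\<And>l. l \<in> {1..r} \<Longrightarrow> E l \<noteq> {}"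
    and "\<H> \<subseteq> (\<Pi>\<^sub>E i\<in>{1..n}. Xs i) \<rightarrow>\<^sub>E Y"
    and "\<And>j. j \<in> {1..t} \<Longrightarrow>
           compact_space (K j) \<and> Hausdorff_space (K j) \<and> topspace (K j) \<noteq> {}"
    and "\<And>j. j \<in> {1..t} \<Longrightarrow> banach_module (G j)"
    and R_nonneg: "\<And>j \<phi> x b. \<lbrakk>j \<in> {1..t}; \<phi> \<in> topspace (K j);
           x \<in> (\<Pi>\<^sub>E l\<in>{1..r}. E l); b \<in> carrier (G j)\<rbrakk> \<Longrightarrow> 0 \<le> R j \<phi> x b"
    and S_nonneg: "\<And>h x b. \<lbrakk>h \<in> \<H>; x \<in> (\<Pi>\<^sub>E l\<in>{1..r}. E l);
           b \<in> (\<Pi>\<^sub>E k\<in>{1..t}. carrier (G k))\<rbrakk> \<Longrightarrow> 0 \<le> S h x b"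
    and R_continuous: "\<And>j x b. \<lbrakk>j \<in> {1..t}; x \<in> (\<Pi>\<^sub>E l\<in>{1..r}. E l); b \<in> carrier (G j)\<rbrakk>
           \<Longrightarrow> continuous_map (K j) (top_of_set {0..}) (\<lambda>\<phi>. R j \<phi> x b)"
    and R_scale: "\<And>j \<phi> x b \<eta>. \<lbrakk>j \<in> {1..t}; \<phi> \<in> topspace (K j);
           x \<in> (\<Pi>\<^sub>E l\<in>{1..r}. E l); b \<in> carrier (G j); 0 \<le> \<eta>; \<eta> \<le> 1\<rbrakk>
           \<Longrightarrow> R j \<phi> x (of_real \<eta> \<odot>\<^bsub>G j\<^esub> b) \<le> \<eta> * R j \<phi> x b"
    and S_scale: "\<And>h x b \<alpha>. \<lbrakk>h \<in> \<H>; x \<in> (\<Pi>\<^sub>E l\<in>{1..r}. E l);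
           b \<in> (\<Pi>\<^sub>E k\<in>{1..t}. carrier (G k)); \<And>k. k \<in> {1..t} \<Longrightarrow> 0 \<le> \<alpha> k \<and> \<alpha> k \<le> 1\<rbrakk>
           \<Longrightarrow> S h x (\<lambda>k\<in>{1..t}. of_real (\<alpha> k) \<odot>\<^bsub>G k\<^esub> b k) \<ge> (\<Prod>k=1..t. \<alpha> k) * S h x b"
    and "f \<in> \<H>"
    and "0 < pstar" and "0 < u" and "0 < s"
    and "\<And>k. k \<in> {1..t-1} \<Longrightarrow> 0 < p k" and "\<And>k. k \<in> {1..t-1} \<Longrightarrow> 0 < q k"
    and "1 / u = (\<Sum>k=1..t-1. 1 / p k) + 1 / pstar"
    and "1 / s = (\<Sum>k=1..t-1. 1 / q k) + 1 / pstar"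
    and R_constant: "\<And>k x b. \<lbrakk>k \<in> {1..t-1}; x \<in> (\<Pi>\<^sub>E l\<in>{1..r}. E l); b \<in> carrier (G k)\<rbrakk>
           \<Longrightarrow> (\<lambda>\<phi>. R k \<phi> x b) constant_on topspace (K k)"
  shows "abstract_summing r t E K G R S (p(t := pstar)) f \<longleftrightarrow>
         abstract_summing r t E K G R S (q(t := pstar)) f"
proof -
  interpret constant_but_last r t E K G R S f
  proof
    show "1 \<le> t"
      using \<open>t \<ge> 2\<close> by simp
    then have "t \<in> {1..t}"
      by simp
    then show "compact_space (K t)"
      using assms(8) by blast
    show "topspace (K k) \<noteq> {}" if "k \<in> {1..t}" for k
      using assms(8) that by blast
    show "c \<odot>\<^bsub>G k\<^esub> b \<in> carrier (G k)" if "k \<in> {1..t}" "b \<in> carrier (G k)" for k c b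
    proof -
      interpret banach_module "G k"
        using assms(9) that(1) by blast
      show ?thesis
        using that(2) by (intro smult_closed) (simp_all add: ring_of_type_algebra_def)
    qed
    show "continuous_map (K t) euclideanreal (\<lambda>\<phi>. R t \<phi> x b)"
      if "x \<in> (\<Pi>\<^sub>E l\<in>{1..r}. E l)" "b \<in> carrier (G t)" for x b
      using R_continuous[OF \<open>t \<in> {1..t}\<close> that] by (simp add: continuous_map_in_subtopology)
    show "0 \<le> R k \<phi> x b" if "k \<in> {1..t}" "\<phi> \<in> topspace (K k)"
        "x \<in> (\<Pi>\<^sub>E l\<in>{1..r}. E l)" "b \<in> carrier (G k)" for k \<phi> x b
      using that by (rule R_nonneg)
    show "0 \<le> S f x b"
      if "x \<in> (\<Pi>\<^sub>E l\<in>{1..r}. E l)" "b \<in> (\<Pi>\<^sub>E k\<in>{1..t}. carrier (G k))" for x b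
      using \<open>f \<in> \<H>\<close> that by (rule S_nonneg)
    show "R k \<phi> x (of_real \<eta> \<odot>\<^bsub>G k\<^esub> b) \<le> \<eta> * R k \<phi> x b"
      if "k \<in> {1..t}" "\<phi> \<in> topspace (K k)" "x \<in> (\<Pi>\<^sub>E l\<in>{1..r}. E l)" "b \<in> carrier (G k)"
        "0 \<le> \<eta>" "\<eta> \<le> 1" for k \<phi> x b \<eta>
      using that by (rule R_scale)
    show "(\<Prod>k=1..t. \<alpha> k) * S f x b \<le> S f x (\<lambda>k\<in>{1..t}. of_real (\<alpha> k) \<odot>\<^bsub>G k\<^esub> b k)"
      if "x \<in> (\<Pi>\<^sub>E l\<in>{1..r}. E l)" "b \<in> (\<Pi>\<^sub>E k\<in>{1..t}. carrier (G k))"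
        "\<And>k. k \<in> {1..t} \<Longrightarrow> 0 \<le> \<alpha> k \<and> \<alpha> k \<le> 1" for x b \<alpha>
      using \<open>f \<in> \<H>\<close> that by (rule S_scale)
    show "(\<lambda>\<phi>. R k \<phi> x b) constant_on topspace (K k)"
      if "k \<in> {1..t-1}" "x \<in> (\<Pi>\<^sub>E l\<in>{1..r}. E l)" "b \<in> carrier (G k)" for k x b
      using that by (rule R_constant)
  qed
  have "0 < (p(t := pstar)) k" "0 < (q(t := pstar)) k" if "k \<in> {1..t}" for k
    using that \<open>0 < pstar\<close> assms(19,20)[of k] by auto
  then show ?thesis
    using abstract_summing_iff_normalized_summing[of "p(t := pstar)"]
      abstract_summing_iff_normalized_summing[of "q(t := pstar)"] by simp
qed

end
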